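(* Let $\mathcal{H}$ be a complex Hilbert space, $T_2,T_3\in\mathcal{L}(\mathcal{H})$ and $q\in(0,1)$. Then $$w_q\left(\begin{bmatrix} O & T_2 \\ {} T_3 & O \end{bmatrix}\right)\le\frac{q+2\sqrt{1-q^2}}{q}\min\{w_q(T_2),w_q(T_3)\}+\left(\sqrt{1-\frac{3q^2}{4}+q\sqrt{1-q^2}}\right)\min\{\|T_2+T_3\|,\|T_2-T_3\|\}.$$
   Context: $\mathcal{L}(\mathcal{H})$ is the algebra of bounded linear operators on the complex Hilbert space $\mathcal{H}$, with operator norm $\|\cdot\|$. For $q\in\mathbb{C}$ with $|q|\le 1$, the $q$-numerical radius of a bounded operator $T$ on a Hilbert space $\mathcal{K}$ is $w_q(T)=\sup\{|\langle Tx,y\rangle| : x,y\in\mathcal{K},\ \|x\|=\|y\|=1,\ \langle x,y\rangle=q\}$. When $|q|<1$ it is understood that $\dim\mathcal{H}\ge 2$, so that this supremum is over a nonempty set. A $2\times2$ operator matrix with entries in $\mathcal{L}(\mathcal{H})$ acts on the Hilbert space direct sum $\mathcal{H}\oplus\mathcal{H}$; $O$ is the zero operator. *)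

theory Defs
  imports "HOL-Analysis.Analysis"
begin

class complex_vector = real_vector +
  fixes scaleC :: "complex \<Rightarrow> 'a \<Rightarrow> 'a" (infixr "*\<^sub>C" 75)
  assumes scaleC_add_right: "c *\<^sub>C (x + y) = c *\<^sub>C x + c *\<^sub>C y"
    and scaleC_add_left: "(c + d) *\<^sub>C x = c *\<^sub>C x + d *\<^sub>C x"
    and scaleC_scaleC: "c *\<^sub>C (d *\<^sub>C x) = (c * d) *\<^sub>C x"
    and scaleC_one: "1 *\<^sub>C x = x"
    and scaleR_scaleC: "r *\<^sub>R x = complex_of_real r *\<^sub>C x"

global_interpretation complex_vector: vector_space "scaleC :: complex \<Rightarrow> 'a \<Rightarrow> 'a::complex_vector"
  by standard (simp_all add: scaleC_add_right scaleC_add_left scaleC_scaleC scaleC_one)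

(* The inner product is linear in the first and conjugate-linear in the second argument.
   Positive definiteness is contained in the last axiom. *)
class complex_inner = complex_vector + real_normed_vector +
  fixes cinner :: "'a \<Rightarrow> 'a \<Rightarrow> complex"
  assumes cinner_commute: "cinner x y = cnj (cinner y x)"
    and cinner_add_left: "cinner (x + y) z = cinner x z + cinner y z"
    and cinner_scaleC_left: "cinner (c *\<^sub>C x) y = c * cinner x y"
    and cinner_self_norm: "cinner x x = complex_of_real ((norm x)\<^sup>2)"

class chilbert_space = complex_inner + complete_space

instantiation complex :: chilbert_space
begin

definition "c *\<^sub>C (x::complex) = c * x"
definition "cinner (x::complex) y = x * cnj y"

instance
proof
  fix x y z c d :: complex and r :: real
  show "c *\<^sub>C (x + y) = c *\<^sub>C x + c *\<^sub>C y" "(c + d) *\<^sub>C x = c *\<^sub>C x + d *\<^sub>C x"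
    "c *\<^sub>C (d *\<^sub>C x) = (c * d) *\<^sub>C x" "1 *\<^sub>C x = x"
    by (simp_all add: scaleC_complex_def distrib_left distrib_right mult.assoc)
  show "r *\<^sub>R x = complex_of_real r *\<^sub>C x"
    by (simp only: scaleC_complex_def scaleR_conv_of_real)
  show "cinner x y = cnj (cinner y x)"
    by (simp add: cinner_complex_def mult.commute)
  show "cinner (x + y) z = cinner x z + cinner y z" "cinner (c *\<^sub>C x) y = c * cinner x y"
    by (simp_all add: cinner_complex_def scaleC_complex_def distrib_right mult.assoc)
  show "cinner x x = complex_of_real ((norm x)\<^sup>2)"
    by (simp only: cinner_complex_def complex_norm_square)
qed

end

(* The Hilbert space direct sum: the library norm on pairs is
   sqrt ((norm (fst x))^2 + (norm (snd x))^2). *)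
instantiation prod :: (complex_vector, complex_vector) complex_vector
begin

definition "c *\<^sub>C x = (c *\<^sub>C fst x, c *\<^sub>C snd x)"

instance
  by standard
    (simp_all only: scaleC_prod_def scaleR_prod_def plus_prod_def fst_conv snd_conv prod.collapse
      scaleC_add_right scaleC_add_left scaleC_scaleC scaleC_one scaleR_scaleC)

end

instantiation prod :: (complex_inner, complex_inner) complex_inner
begin

definition "cinner x y = cinner (fst x) (fst y) + cinner (snd x) (snd y)"

instance
proof
  fix x y z :: "'a \<times> 'b" and c :: complex
  show "cinner x y = cnj (cinner y x)"
    by (metis cinner_prod_def cinner_commute complex_cnj_add)
  show "cinner (x + y) z = cinner x z + cinner y z"
    by (simp add: cinner_prod_def cinner_add_left)
  show "cinner (c *\<^sub>C x) y = c * cinner x y"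
    by (simp add: cinner_prod_def scaleC_prod_def cinner_scaleC_left distrib_left)
  show "cinner x x = complex_of_real ((norm x)\<^sup>2)"
    by (simp add: cinner_prod_def cinner_self_norm norm_prod_def)
qed

end

instance prod :: (chilbert_space, chilbert_space) chilbert_space ..

(* bounded_linear alone would only give real-linearity. *)
locale bounded_clinear = bounded_linear f
  for f :: "'a::complex_inner \<Rightarrow> 'b::complex_inner" +
  assumes scaleC: "f (c *\<^sub>C x) = c *\<^sub>C f x"

(* Sup is the supremum in the reals: it is meaningful only if the set is nonempty and bounded
   above, i.e. for bounded T and cmod q <= 1, with complex dimension at least 2 if cmod q < 1
   (and at least 1 if cmod q = 1). *)
definition q_numerical_radius :: "complex \<Rightarrow> ('a::complex_inner \<Rightarrow> 'a) \<Rightarrow> real" where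
  "q_numerical_radius q T =
     Sup {cmod (cinner (T x) y) | x y. norm x = 1 \<and> norm y = 1 \<and> cinner x y = q}"

definition block_op ::
  "('a \<Rightarrow> 'a) \<Rightarrow> ('a \<Rightarrow> 'a) \<Rightarrow> ('a \<Rightarrow> 'a) \<Rightarrow> ('a \<Rightarrow> 'a) \<Rightarrow> 'a \<times> 'a \<Rightarrow> 'a::complex_inner \<times> 'a" where
  "block_op A B C D = (\<lambda>(x, y). (A x + B y, C x + D y))"

end

theory Submission
  imports Defs
begin

text \<open>
  Write \<open>s = sqrt (1 - q\<^sup>2)\<close> and let \<open>e\<close> be \<open>1\<close> or \<open>-1\<close>. The off-diagonal matrix with entries \<open>T2\<close>, \<open>T3\<close>
  is the sum of the one with entries \<open>T2\<close>, \<open>e T2\<close> and the one whose only nonzero entry is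
  \<open>T3 - e T2\<close> in the lower left corner. The first has numerical radius at most \<open>w(T2)\<close>, by
  polarization, and norm at most \<open>2 w(T2)\<close>; splitting \<open>y = q x + (y - q x)\<close> bounds its
  \<open>q\<close>-numerical radius by \<open>(q + 2 s) w(T2)\<close>, and \<open>q w(T2) \<le> w\<^sub>q(T2)\<close>. The \<open>q\<close>-numerical radius of
  the second is at most \<open>(1 + s) / 2\<close> times the norm of \<open>T3 - e T2\<close>, and
  \<open>(1 + s) / 2\<close> is below the square root in the claim. Swapping the two summands
  of the direct sum exchanges the roles of \<open>T2\<close> and \<open>T3\<close>.
\<close>

section \<open>Inner product algebra, Pythagoras and Cauchy-Schwarz\<close>

lemma cinner_add_right: "cinner x (y + z) = cinner x y + cinner x (z::'a::complex_inner)"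
  by (metis cinner_add_left cinner_commute complex_cnj_add)

lemma cinner_scaleC_right: "cinner x (c *\<^sub>C y) = cnj c * cinner x (y::'a::complex_inner)"
  by (metis cinner_commute cinner_scaleC_left complex_cnj_mult)

lemma cinner_diff_left: "cinner (x - y) z = cinner x z - cinner y (z::'a::complex_inner)"
  by (metis cinner_add_left add_diff_cancel diff_add_cancel)

lemma cinner_diff_right: "cinner x (y - z) = cinner x y - cinner x (z::'a::complex_inner)"
  by (metis cinner_add_right add_diff_cancel diff_add_cancel)

lemma cinner_scaleR_left: "cinner (r *\<^sub>R x) y = of_real r * cinner x (y::'a::complex_inner)"
  by (simp add: scaleR_scaleC cinner_scaleC_left)

lemma cinner_scaleR_right: "cinner x (r *\<^sub>R y) = of_real r * cinner x (y::'a::complex_inner)"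
  by (simp add: scaleR_scaleC cinner_scaleC_right)

lemma cinner_zero_left [simp]: "cinner 0 (x::'a::complex_inner) = 0"
  using cinner_diff_left[of 0 0 x] by simp

lemma cinner_zero_right [simp]: "cinner (x::'a::complex_inner) 0 = 0"
  using cinner_diff_right[of x 0 0] by simp

lemmas cinner_algebra = cinner_add_left cinner_add_right cinner_diff_left cinner_diff_right
  cinner_scaleC_left cinner_scaleC_right cinner_scaleR_left cinner_scaleR_right

lemma norm_scaleC: "norm (c *\<^sub>C x) = cmod c * norm (x::'a::complex_inner)"
proof -
  have "complex_of_real ((norm (c *\<^sub>C x))\<^sup>2) = complex_of_real ((cmod c * norm x)\<^sup>2)"
    unfolding cinner_self_norm[of "c *\<^sub>C x", symmetric] power_mult_distrib of_real_mult
      complex_norm_square cinner_self_norm[of x, symmetric]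
    by (simp add: cinner_algebra)
  then show ?thesis
    by (metis of_real_eq_iff power2_eq_iff_nonneg norm_ge_zero mult_nonneg_nonneg)
qed

text \<open>Pythagoras for the component of \<open>y\<close> orthogonal to \<open>x\<close>. Its
  nonnegativity gives Cauchy-Schwarz; its exact length is needed when \<open>cinner y x\<close> is
  \<open>q\<close>.\<close>

lemma norm_diff_projection:
  fixes x y :: "'a::complex_inner"
  assumes "norm x = 1"
  shows "(norm (y - cinner y x *\<^sub>C x))\<^sup>2 = (norm y)\<^sup>2 - (cmod (cinner y x))\<^sup>2"
proof -
  have "cinner x x = 1" using assms by (simp add: cinner_self_norm)
  moreover have "cinner x y = cnj (cinner y x)" by (rule cinner_commute)
  ultimately have "complex_of_real ((norm (y - cinner y x *\<^sub>C x))\<^sup>2)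
      = complex_of_real ((norm y)\<^sup>2 - (cmod (cinner y x))\<^sup>2)"
    unfolding of_real_diff complex_norm_square
      cinner_self_norm[of "y - cinner y x *\<^sub>C x", symmetric] cinner_self_norm[of y, symmetric]
    by (simp add: cinner_algebra)
  then show ?thesis by (simp only: of_real_eq_iff)
qed

lemma cinner_Cauchy_Schwarz: "cmod (cinner x y) \<le> norm x * norm (y::'a::complex_inner)"
proof (cases "y = 0")
  case False
  define u where "u = (1 / norm y) *\<^sub>R y"
  have u: "norm u = 1" using False by (simp add: u_def)
  have "(cmod (cinner x u))\<^sup>2 \<le> (norm x)\<^sup>2"
    using norm_diff_projection[OF u, of x] zero_le_power2[of "norm (x - cinner x u *\<^sub>C u)"] by linarith
  then have "cmod (cinner x u) \<le> norm x"
    by (rule power2_le_imp_le) simp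
  then show ?thesis
    using False by (simp add: u_def cinner_algebra norm_divide field_simps)
qed simp

lemma parallelogram:
  fixes a b :: "'a::complex_inner"
  shows "(norm (a + b))\<^sup>2 + (norm (a - b))\<^sup>2 = 2 * ((norm a)\<^sup>2 + (norm b)\<^sup>2)"
proof -
  have "complex_of_real ((norm (a + b))\<^sup>2 + (norm (a - b))\<^sup>2)
      = complex_of_real (2 * ((norm a)\<^sup>2 + (norm b)\<^sup>2))"
    unfolding of_real_add of_real_mult cinner_self_norm[symmetric] by (simp add: cinner_algebra)
  then show ?thesis by (simp only: of_real_eq_iff)
qed

section \<open>Unit vectors with a prescribed inner product\<close>

text \<open>One Gram-Schmidt step: two independent vectors cannot both be multiples of
  \<open>x\<close>, so one of them leaves a nonzero remainder after projection. Dimension at least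
  two enters here.\<close>

lemma exists_unit_orthogonal:
  fixes x :: "'a::complex_inner" and B :: "'a set"
  assumes B: "card B = 2" "complex_vector.independent B" and x: "norm x = 1"
  obtains z where "norm z = 1" "cinner x z = 0"
proof -
  obtain u v where uv: "B = {u, v}" "u \<noteq> v" using B(1) by (auto simp: card_2_iff)
  have "\<exists>w \<in> B. w \<noteq> cinner w x *\<^sub>C x"
  proof (rule ccontr)
    assume "\<not> ?thesis"
    then have u: "u = cinner u x *\<^sub>C x" and v: "v = cinner v x *\<^sub>C x" using uv by auto
    have "u \<noteq> 0" using B(2) uv complex_vector.dependent_zero by blast
    then have c: "cinner u x \<noteq> 0"
      using u complex_vector.scale_zero_left by metis
    \<comment> \<open>If both vectors lie on the line of \<open>x\<close>, then \<open>v\<close> is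
      a multiple of the nonzero \<open>u\<close>, contradicting independence.\<close>
    have "(cinner v x / cinner u x) *\<^sub>C u = (cinner v x / cinner u x) *\<^sub>C (cinner u x *\<^sub>C x)"
      using u by simp
    also have "\<dots> = v" using v c by (simp add: scaleC_scaleC)
    finally have "v \<in> complex_vector.span {u}"
      by (metis complex_vector.span_base complex_vector.span_scale insertI1)
    moreover have "B - {v} = {u}" using uv by auto
    ultimately show False using B(2) uv unfolding complex_vector.dependent_def by auto
  qed
  then obtain w where w: "w \<noteq> cinner w x *\<^sub>C x" by blast
  define p where "p = w - cinner w x *\<^sub>C x"
  have "p \<noteq> 0" using w by (simp add: p_def)
  have "cinner x x = 1" using x by (simp add: cinner_self_norm)
  then have "cinner x p = 0"
    using cinner_commute[of x w] by (simp add: p_def cinner_algebra)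
  show thesis
    using \<open>p \<noteq> 0\<close> \<open>cinner x p = 0\<close> that[of "(1 / norm p) *\<^sub>R p"] by (simp add: cinner_algebra)
qed

lemma q_tilted_unit_vector:
  fixes x z :: "'a::complex_inner"
  assumes "norm x = 1" "norm z = 1" "cinner x z = 0" "q\<^sup>2 + t\<^sup>2 = 1"
  shows "norm (q *\<^sub>R x + t *\<^sub>R z) = 1" "cinner x (q *\<^sub>R x + t *\<^sub>R z) = of_real q"
proof -
  have 1: "cinner x x = 1" "cinner z z = 1" using assms by (simp_all add: cinner_self_norm)
  have 0: "cinner z x = 0" using assms(3) cinner_commute[of z x] by simp
  have "complex_of_real ((norm (q *\<^sub>R x + t *\<^sub>R z))\<^sup>2) = complex_of_real (q\<^sup>2 + t\<^sup>2)"
    unfolding cinner_self_norm[symmetric]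
    by (simp add: cinner_algebra 1 0 assms(3) power2_eq_square)
  then have "(norm (q *\<^sub>R x + t *\<^sub>R z))\<^sup>2 = 1" using assms(4) by (simp only: of_real_eq_iff)
  then show "norm (q *\<^sub>R x + t *\<^sub>R z) = 1" by (simp add: power2_eq_1_iff)
      (metis norm_ge_zero abs_norm_cancel abs_neg_one neg_0_le_iff_le not_one_le_zero)
  show "cinner x (q *\<^sub>R x + t *\<^sub>R z) = of_real q" by (simp add: cinner_algebra 1 assms(3))
qed

section \<open>Comparison of the \<open>q\<close>-numerical radius with the numerical radius\<close>

text \<open>By Cauchy-Schwarz the operator norm bounds the set from above, so its \<open>Sup\<close>
  is a genuine supremum.\<close>

lemma q_numerical_radius_upper:
  fixes T :: "'a::complex_inner \<Rightarrow> 'a"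
  assumes "bounded_clinear T" "norm x = 1" "norm y = 1" "cinner x y = q"
  shows "cmod (cinner (T x) y) \<le> q_numerical_radius q T"
  unfolding q_numerical_radius_def
proof (rule cSup_upper)
  interpret bounded_clinear T by fact
  show "bdd_above {cmod (cinner (T x) y) | x y. norm x = 1 \<and> norm y = 1 \<and> cinner x y = q}"
  proof (rule bdd_aboveI)
    fix r assume "r \<in> {cmod (cinner (T x) y) | x y. norm x = 1 \<and> norm y = 1 \<and> cinner x y = q}"
    then obtain u v where "r = cmod (cinner (T u) v)" "norm u = 1" "norm v = 1" by blast
    then show "r \<le> onorm T"
      using cinner_Cauchy_Schwarz[of "T u" v] onorm[OF bounded_linear_axioms, of u] by simp
  qed
qed (use assms in blast)

text \<open>For a unit vector \<open>u\<close> and a unit \<open>z\<close> orthogonal to it, both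
  \<open>q u + t z\<close> and \<open>q u - t z\<close> are admissible partners of \<open>u\<close>.
  Adding the two values cancels \<open>z\<close> and leaves \<open>2 q\<close> times the quadratic
  form at \<open>u\<close>; homogeneity does the rest.\<close>

lemma numerical_radius_le_q_numerical_radius:
  fixes T :: "'a::complex_inner \<Rightarrow> 'a" and q :: real
  assumes dim: "\<exists>B::'a set. card B = 2 \<and> complex_vector.independent B"
    and T: "bounded_clinear T" and q: "0 < q" "q < 1"
  shows "cmod (cinner (T x) x) \<le> q_numerical_radius (of_real q) T / q * (norm x)\<^sup>2"
proof (cases "x = 0")
  case False
  interpret bounded_clinear T by fact
  define u where "u = (1 / norm x) *\<^sub>R x"
  have u: "norm u = 1" and xu: "x = norm x *\<^sub>R u" using False by (simp_all add: u_def)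
  obtain z where z: "norm z = 1" "cinner u z = 0"
    using dim exists_unit_orthogonal[OF _ _ u] by metis
  define t where "t = sqrt (1 - q\<^sup>2)"
  have t: "q\<^sup>2 + t\<^sup>2 = 1" "q\<^sup>2 + (- t)\<^sup>2 = 1"
    using q by (simp_all add: t_def power_le_one)
  let ?y = "\<lambda>t. q *\<^sub>R u + t *\<^sub>R z"
  have "complex_of_real (2 * q) * cinner (T u) u = cinner (T u) (?y t) + cinner (T u) (?y (- t))"
    by (simp add: cinner_algebra cinner_scaleR_right[of _ "- t", simplified])
  also have "cmod \<dots> \<le> 2 * q_numerical_radius (of_real q) T"
    using norm_triangle_ineq[of "cinner (T u) (?y t)" "cinner (T u) (?y (- t))"]
      q_numerical_radius_upper[OF T u q_tilted_unit_vector[OF u z t(1)]]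
      q_numerical_radius_upper[OF T u q_tilted_unit_vector[OF u z t(2)]] by linarith
  finally have "q * cmod (cinner (T u) u) \<le> q_numerical_radius (of_real q) T"
    using q by (simp add: norm_mult)
  then have *: "cmod (cinner (T u) u) \<le> q_numerical_radius (of_real q) T / q"
    using q by (simp add: field_simps)
  have "cinner (T x) x = of_real ((norm x)\<^sup>2) * cinner (T u) u"
    by (subst (1 2) xu) (simp only: scaleR cinner_algebra of_real_mult power2_eq_square mult.assoc)
  then show ?thesis
    using mult_right_mono[OF *, of "(norm x)\<^sup>2"] by (simp add: norm_mult norm_power mult.commute)
qed (use T bounded_clinear.axioms(1) linear_simps(3) in force)

section \<open>Consequences of a numerical radius bound \<open>W\<close>\<close>

text \<open>The left side is the quadratic form of the matrix with off-diagonal entries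
  \<open>T\<close> and \<open>e T\<close> at the pair \<open>(a, b)\<close>. For
  \<open>e = 1\<close> it comes from the forms of \<open>T\<close> at \<open>a + b\<close> and
  \<open>a - b\<close>.\<close>

lemma polarization_bound:
  fixes T :: "'a::complex_inner \<Rightarrow> 'a"
  assumes T: "bounded_clinear T"
    and W: "\<And>x. cmod (cinner (T x) x) \<le> W * (norm x)\<^sup>2"
    and e: "e = 1 \<or> e = - 1"
  shows "cmod (cinner (T b) a + of_real e * cinner (T a) b) \<le> W * ((norm a)\<^sup>2 + (norm b)\<^sup>2)"
proof -
  interpret bounded_clinear T by fact
  have sum: "cmod (cinner (T b) a + cinner (T a) b) \<le> W * ((norm a)\<^sup>2 + (norm b)\<^sup>2)" for a b
  proof -
    have "2 * (cinner (T b) a + cinner (T a) b)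
        = cinner (T (a + b)) (a + b) - cinner (T (a - b)) (a - b)"
      by (simp add: add diff cinner_algebra)
    then have "2 * cmod (cinner (T b) a + cinner (T a) b)
        = cmod (cinner (T (a + b)) (a + b) - cinner (T (a - b)) (a - b))"
      by (metis norm_mult norm_numeral)
    also have "\<dots> \<le> W * (norm (a + b))\<^sup>2 + W * (norm (a - b))\<^sup>2"
      using norm_triangle_ineq4 W add_mono order_trans by meson
    also have "\<dots> = 2 * (W * ((norm a)\<^sup>2 + (norm b)\<^sup>2))"
      unfolding distrib_left[symmetric] parallelogram by simp
    finally show ?thesis by simp
  qed
  \<comment> \<open>The case \<open>e = - 1\<close> follows by putting
    \<open>\<i> *\<^sub>C b\<close> for \<open>b\<close>: conjugate-linearity in the second argument
    flips the sign of one term and norms do not change.\<close>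
  have "cinner (T (\<i> *\<^sub>C b)) a + cinner (T a) (\<i> *\<^sub>C b)
      = \<i> * (cinner (T b) a - cinner (T a) b)"
    by (simp add: scaleC cinner_algebra algebra_simps)
  then have "cmod (cinner (T (\<i> *\<^sub>C b)) a + cinner (T a) (\<i> *\<^sub>C b))
      = cmod (cinner (T b) a - cinner (T a) b)"
    by (simp add: norm_mult)
  then have "cmod (cinner (T b) a - cinner (T a) b) \<le> W * ((norm a)\<^sup>2 + (norm b)\<^sup>2)"
    using sum[of "\<i> *\<^sub>C b" a] by (simp add: norm_scaleC)
  then show ?thesis using sum[of b a] e by auto
qed

lemma norm_le_twice_numerical_radius:
  fixes T :: "'a::complex_inner \<Rightarrow> 'a"
  assumes T: "bounded_clinear T"
    and W: "\<And>x. cmod (cinner (T x) x) \<le> W * (norm x)\<^sup>2"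
  shows "norm (T b) \<le> 2 * W * norm b"
proof (cases "T b = 0 \<or> b = 0")
  case True
  interpret bounded_clinear T by fact
  show ?thesis
  proof (cases "b = 0")
    case False
    \<comment> \<open>A nonzero \<open>b\<close> forces \<open>W\<close> to be nonnegative.\<close>
    have "0 \<le> W * (norm b)\<^sup>2" using W[of b] norm_ge_zero order_trans by blast
    then have "0 \<le> W" using False by (simp add: zero_le_mult_iff)
    then show ?thesis using True False by simp
  qed (simp add: zero)
next
  case False
  interpret bounded_clinear T by fact
  \<comment> \<open>\<open>a\<close> points along \<open>T b\<close>, so that
    \<open>cinner (T b) a\<close> is \<open>norm (T b) * norm a\<close>; its length is that of
    \<open>b\<close>, which makes the polarization bound \<open>2 W\<close> times the square of
    \<open>norm b\<close>. Adding both signs cancels \<open>cinner (T a) b\<close>.\<close>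
  define a where "a = (norm b / norm (T b)) *\<^sub>R T b"
  have na: "norm a = norm b" using False by (simp add: a_def)
  have "2 * cinner (T b) a = (cinner (T b) a + of_real 1 * cinner (T a) b)
      + (cinner (T b) a + of_real (- 1) * cinner (T a) b)"
    by simp
  then have "2 * cmod (cinner (T b) a) \<le> cmod (cinner (T b) a + of_real 1 * cinner (T a) b)
      + cmod (cinner (T b) a + of_real (- 1) * cinner (T a) b)"
    by (metis norm_mult norm_numeral norm_triangle_ineq)
  also have "\<dots> \<le> W * ((norm a)\<^sup>2 + (norm b)\<^sup>2) + W * ((norm a)\<^sup>2 + (norm b)\<^sup>2)"
    by (intro add_mono polarization_bound T W) auto
  finally have "cmod (cinner (T b) a) \<le> 2 * W * norm b * norm b"
    by (simp add: na power2_eq_square)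
  moreover have "cinner (T b) a = of_real (norm b * norm (T b))"
    using False by (simp add: a_def cinner_algebra cinner_self_norm power2_eq_square)
  ultimately have "norm b * norm (T b) \<le> norm b * (2 * W * norm b)"
    by (simp add: norm_mult algebra_simps)
  then show ?thesis using False by simp
qed

section \<open>Scalar inequalities for the corner term\<close>

text \<open>Average of two bounds: Lagrange's identity controls
  \<open>\<alpha> * \<delta> - \<beta> * \<gamma>\<close> by \<open>sqrt (1 - q\<^sup>2)\<close>,
  and the arithmetic-geometric mean inequality gives
  \<open>\<alpha> * \<delta> + \<beta> * \<gamma> \<le> 1\<close>.\<close>

lemma corner_product_bound:
  fixes \<alpha> \<beta> \<gamma> \<delta> q :: real
  assumes "\<alpha>\<^sup>2 + \<beta>\<^sup>2 = 1" "\<gamma>\<^sup>2 + \<delta>\<^sup>2 = 1" "0 \<le> q" "q \<le> \<alpha> * \<gamma> + \<beta> * \<delta>"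
  shows "\<alpha> * \<delta> \<le> (1 + sqrt (1 - q\<^sup>2)) / 2"
proof -
  have "(\<alpha> * \<delta> - \<beta> * \<gamma>)\<^sup>2 + (\<alpha> * \<gamma> + \<beta> * \<delta>)\<^sup>2 = (\<alpha>\<^sup>2 + \<beta>\<^sup>2) * (\<gamma>\<^sup>2 + \<delta>\<^sup>2)"
    by (simp add: power2_eq_square algebra_simps)
  moreover have "q\<^sup>2 \<le> (\<alpha> * \<gamma> + \<beta> * \<delta>)\<^sup>2" using assms(3,4) by (rule power_mono[rotated])
  ultimately have "(\<alpha> * \<delta> - \<beta> * \<gamma>)\<^sup>2 \<le> 1 - q\<^sup>2" using assms(1,2) by simp
  then have "\<alpha> * \<delta> - \<beta> * \<gamma> \<le> sqrt (1 - q\<^sup>2)" by (rule real_le_rsqrt)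
  moreover have "\<alpha> * \<delta> + \<beta> * \<gamma> \<le> 1"
    using sum_squares_bound[of \<alpha> \<delta>] sum_squares_bound[of \<beta> \<gamma>] assms(1,2) by linarith
  ultimately show ?thesis by simp
qed

text \<open>With \<open>s = sqrt (1 - q\<^sup>2)\<close>, squaring reduces the claim to
  \<open>s * (1 - s) \<le> s * (2 * q)\<close>. This holds since
  \<open>1 - s \<le> 1 - s\<^sup>2 = q\<^sup>2 \<le> q\<close>.\<close>

lemma half_one_plus_sqrt_le:
  fixes q :: real
  assumes "0 < q" "q < 1"
  shows "(1 + sqrt (1 - q\<^sup>2)) / 2 \<le> sqrt (1 - 3 * q\<^sup>2 / 4 + q * sqrt (1 - q\<^sup>2))"
proof (rule real_le_rsqrt)
  define s where "s = sqrt (1 - q\<^sup>2)"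
  have q2: "q\<^sup>2 \<le> 1" using assms by (simp add: power_le_one)
  then have s: "0 \<le> s" "s\<^sup>2 = 1 - q\<^sup>2" by (simp_all add: s_def)
  then have "s \<le> 1" by (intro power2_le_imp_le[of s 1]) simp_all
  then have "s\<^sup>2 \<le> s" using mult_left_mono[of s 1 s] s(1) by (simp add: power2_eq_square)
  moreover have "q\<^sup>2 \<le> q" using assms mult_left_mono[of q 1 q] by (simp add: power2_eq_square)
  ultimately have "1 - s \<le> 2 * q" using s assms by linarith
  then have "s * (1 - s) \<le> s * (2 * q)" using s(1) by (rule mult_left_mono)
  then have "((1 + s) / 2)\<^sup>2 \<le> 1 - 3 * q\<^sup>2 / 4 + q * s"
    using s(2) by (simp add: power2_eq_square algebra_simps add_divide_distrib)
  then show "((1 + sqrt (1 - q\<^sup>2)) / 2)\<^sup>2 \<le> 1 - 3 * q\<^sup>2 / 4 + q * sqrt (1 - q\<^sup>2)"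
    by (simp only: s_def)
qed

section \<open>Off-diagonal operator matrices\<close>

text \<open>In \<open>y = q x + (y - q x)\<close> the first part meets the numerical radius bound
  \<open>W\<close>; the second has length \<open>sqrt (1 - q\<^sup>2)\<close> and meets the norm
  bound \<open>2 W\<close>, inherited from the two components.\<close>

lemma signed_offdiag_bound:
  fixes T :: "'a::complex_inner \<Rightarrow> 'a" and x y :: "'a \<times> 'a"
  assumes T: "bounded_clinear T"
    and W: "\<And>x. cmod (cinner (T x) x) \<le> W * (norm x)\<^sup>2" and e: "e = 1 \<or> e = - 1"
    and xy: "norm x = 1" "norm y = 1" "cinner x y = of_real q" and q: "0 \<le> q"
  shows "cmod (cinner (T (snd x), e *\<^sub>R T (fst x)) y) \<le> (q + 2 * sqrt (1 - q\<^sup>2)) * W"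
proof -
  define S where "S = (T (snd x), e *\<^sub>R T (fst x))"
  have sq: "(norm x)\<^sup>2 = (norm (fst x))\<^sup>2 + (norm (snd x))\<^sup>2"
    by (simp add: norm_prod_def)
  have "cinner S x = cinner (T (snd x)) (fst x) + of_real e * cinner (T (fst x)) (snd x)"
    by (simp add: S_def cinner_prod_def cinner_algebra)
  then have Sx: "cmod (cinner S x) \<le> W"
    using polarization_bound[OF T W e, of "snd x" "fst x"] sq xy(1) by simp
  have W0: "0 \<le> W" using Sx norm_ge_zero order_trans by blast
  have "(norm S)\<^sup>2 = (norm (T (snd x)))\<^sup>2 + (norm (T (fst x)))\<^sup>2"
    using e by (auto simp: S_def norm_prod_def)
  also have "\<dots> \<le> (2 * W * norm (snd x))\<^sup>2 + (2 * W * norm (fst x))\<^sup>2"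
    by (intro add_mono power_mono norm_le_twice_numerical_radius T W) auto
  also have "\<dots> = (2 * W)\<^sup>2 * (norm x)\<^sup>2"
    unfolding sq by (simp add: power_mult_distrib distrib_left)
  finally have "(norm S)\<^sup>2 \<le> (2 * W)\<^sup>2" using xy(1) by simp
  then have S: "norm S \<le> 2 * W" using W0 by (intro power2_le_imp_le[of "norm S"]) simp_all
  have yx: "cinner y x = of_real q" using xy(3) cinner_commute[of y x] by simp
  have "norm (y - of_real q *\<^sub>C x) = sqrt (1 - q\<^sup>2)"
    using norm_diff_projection[OF xy(1), of y] xy(2) q unfolding yx
    by (simp add: real_sqrt_unique)
  then have 2: "cmod (cinner S (y - of_real q *\<^sub>C x)) \<le> 2 * W * sqrt (1 - q\<^sup>2)"
    using cinner_Cauchy_Schwarz[of S "y - of_real q *\<^sub>C x"] S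
    by (metis mult_right_mono norm_ge_zero order_trans)
  have "cinner S y = of_real q * cinner S x + cinner S (y - of_real q *\<^sub>C x)"
    by (simp add: cinner_algebra)
  then have "cmod (cinner S y) \<le> q * cmod (cinner S x) + cmod (cinner S (y - of_real q *\<^sub>C x))"
    by (metis abs_of_nonneg norm_mult norm_of_real norm_triangle_ineq q)
  also have "\<dots> \<le> q * W + 2 * W * sqrt (1 - q\<^sup>2)"
    using 2 mult_left_mono[OF Sx q] by linarith
  finally show ?thesis by (simp add: S_def algebra_simps)
qed

lemma offdiag_bound:
  fixes T S :: "'a::complex_inner \<Rightarrow> 'a" and x y :: "'a \<times> 'a"
  assumes T: "bounded_clinear T" and S: "bounded_clinear S"
    and W: "\<And>x. cmod (cinner (T x) x) \<le> W * (norm x)\<^sup>2" and e: "e = 1 \<or> e = - 1"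
    and xy: "norm x = 1" "norm y = 1" "cinner x y = of_real q" and q: "0 < q" "q < 1"
  shows "cmod (cinner (T (snd x), S (fst x)) y) \<le> (q + 2 * sqrt (1 - q\<^sup>2)) * W
    + sqrt (1 - 3 * q\<^sup>2 / 4 + q * sqrt (1 - q\<^sup>2)) * onorm (\<lambda>x. S x - e *\<^sub>R T x)"
proof -
  let ?D = "\<lambda>x. S x - e *\<^sub>R T x"
  have D: "bounded_linear ?D"
    by (intro bounded_linear_sub bounded_linear_const_scaleR bounded_clinear.axioms(1)[OF T]
        bounded_clinear.axioms(1)[OF S])
  have "q = cmod (cinner (fst x) (fst y) + cinner (snd x) (snd y))"
    using xy(3) q by (simp add: cinner_prod_def)
  also have "\<dots> \<le> norm (fst x) * norm (fst y) + norm (snd x) * norm (snd y)"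
    by (intro order_trans[OF norm_triangle_ineq] add_mono cinner_Cauchy_Schwarz)
  \<comment> \<open>The scalar lemma is applied to the component norms of \<open>x\<close> and
    \<open>y\<close>; each pair has square sum 1.\<close>
  finally have "norm (fst x) * norm (snd y) \<le> (1 + sqrt (1 - q\<^sup>2)) / 2"
    using xy q by (intro corner_product_bound) (simp_all add: norm_prod_def)
  then have c: "norm (fst x) * norm (snd y) \<le> sqrt (1 - 3 * q\<^sup>2 / 4 + q * sqrt (1 - q\<^sup>2))"
    using half_one_plus_sqrt_le[OF q] by linarith
  have "cmod (cinner (?D (fst x)) (snd y)) \<le> norm (?D (fst x)) * norm (snd y)"
    by (rule cinner_Cauchy_Schwarz)
  also have "\<dots> \<le> onorm ?D * norm (fst x) * norm (snd y)"
    by (intro mult_right_mono onorm[OF D]) simp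
  also have "\<dots> \<le> sqrt (1 - 3 * q\<^sup>2 / 4 + q * sqrt (1 - q\<^sup>2)) * onorm ?D"
    using mult_left_mono[OF c onorm_pos_le[OF D]] by (simp add: mult_ac)
  finally have "cmod (cinner (?D (fst x)) (snd y))
      \<le> sqrt (1 - 3 * q\<^sup>2 / 4 + q * sqrt (1 - q\<^sup>2)) * onorm ?D" .
  moreover have split: "cinner (T (snd x), S (fst x)) y
      = cinner (T (snd x), e *\<^sub>R T (fst x)) y + cinner (?D (fst x)) (snd y)"
    by (simp add: cinner_prod_def cinner_algebra)
  moreover have "cmod (cinner (T (snd x), e *\<^sub>R T (fst x)) y) \<le> (q + 2 * sqrt (1 - q\<^sup>2)) * W"
    using q by (intro signed_offdiag_bound[OF T W e xy]) simp
  ultimately show ?thesis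
    unfolding split by (intro norm_triangle_le) linarith
qed

theorem theorem2p9:
  fixes T2 T3 :: "'a::chilbert_space \<Rightarrow> 'a" and q :: real
  assumes dim: "\<exists>B::'a set. card B = 2 \<and> complex_vector.independent B"
    and T2: "bounded_clinear T2" and T3: "bounded_clinear T3"
    and q: "0 < q" "q < 1"
  shows "q_numerical_radius (complex_of_real q) (block_op (\<lambda>_. 0) T2 T3 (\<lambda>_. 0))
    \<le> (q + 2 * sqrt (1 - q\<^sup>2)) / q
        * min (q_numerical_radius (complex_of_real q) T2) (q_numerical_radius (complex_of_real q) T3)
      + sqrt (1 - 3 * q\<^sup>2 / 4 + q * sqrt (1 - q\<^sup>2))
        * min (onorm (\<lambda>x. T2 x + T3 x)) (onorm (\<lambda>x. T2 x - T3 x))"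
    (is "_ \<le> ?k * min ?w2 ?w3 + ?c * min ?p ?m")
proof -
  have onorm_swap: "onorm (\<lambda>x. T3 x - T2 x) = ?m"
    unfolding onorm_def by (simp add: norm_minus_commute)
  have onorm_comm: "onorm (\<lambda>x. T3 x + T2 x) = ?p" by (simp add: add.commute)
  note W = numerical_radius_le_q_numerical_radius[OF dim _ q]
  have bound: "cmod (cinner (T2 (snd x), T3 (fst x)) y) \<le> ?k * min ?w2 ?w3 + ?c * min ?p ?m"
    if xy: "norm x = 1" "norm y = 1" "cinner x y = of_real q" for x y :: "'a \<times> 'a"
  proof -
    \<comment> \<open>Swapping the components preserves norms and inner products, so the bound can
      also be used with \<open>T3\<close> as the leading operator.\<close>
    have swap: "norm (prod.swap x) = 1" "norm (prod.swap y) = 1"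
      "cinner (prod.swap x) (prod.swap y) = of_real q"
      using xy by (simp_all add: norm_prod_def cinner_prod_def add.commute)
    let ?l = "cmod (cinner (T2 (snd x), T3 (fst x)) y)"
    have l: "cmod (cinner (T3 (fst x), T2 (snd x)) (prod.swap y)) = ?l"
      by (simp add: cinner_prod_def add.commute)
    \<comment> \<open>One bound for each choice of leading operator and sign: \<open>e = 1\<close>
      gives the difference, \<open>e = - 1\<close> the sum. Together they cover every outcome of the
      two minima.\<close>
    have "?l \<le> ?k * ?w2 + ?c * ?m"
      using offdiag_bound[OF T2 T3 W[OF T2] _ xy q, of 1] by (simp add: onorm_swap)
    moreover have "?l \<le> ?k * ?w2 + ?c * ?p"
      using offdiag_bound[OF T2 T3 W[OF T2] _ xy q, of "- 1"] by (simp add: onorm_comm)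
    moreover have "?l \<le> ?k * ?w3 + ?c * ?m"
      using offdiag_bound[OF T3 T2 W[OF T3] _ swap q, of 1] by (simp add: l)
    moreover have "?l \<le> ?k * ?w3 + ?c * ?p"
      using offdiag_bound[OF T3 T2 W[OF T3] _ swap q, of "- 1"] by (simp add: l)
    ultimately show ?thesis unfolding min_def by (simp split: if_splits)
  qed
  obtain B :: "'a set" where B: "card B = 2" "complex_vector.independent B" using dim by blast
  obtain v :: 'a where "v \<noteq> 0"
    using B by (metis card_2_iff)
  define u where "u = (1 / norm v) *\<^sub>R v"
  have u: "norm u = 1" using \<open>v \<noteq> 0\<close> by (simp add: u_def)
  obtain z where z: "norm z = 1" "cinner u z = 0" using exists_unit_orthogonal[OF B u] .
  have q2: "q\<^sup>2 + (sqrt (1 - q\<^sup>2))\<^sup>2 = 1" using q by (simp add: power_le_one)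
  \<comment> \<open>The least-upper-bound rule for reals needs a nonempty set; a witness pair is
    placed in the first summand.\<close>
  have "\<exists>x y :: 'a \<times> 'a. norm x = 1 \<and> norm y = 1 \<and> cinner x y = of_real q"
    using u q_tilted_unit_vector[OF u z q2]
    by (intro exI[of _ "(u, 0)"] exI[of _ "(q *\<^sub>R u + sqrt (1 - q\<^sup>2) *\<^sub>R z, 0)"])
      (simp add: norm_prod_def cinner_prod_def)
  then show ?thesis
    unfolding q_numerical_radius_def[of _ "block_op _ _ _ _"]
    by (intro cSup_least) (use bound in \<open>auto simp: block_op_def case_prod_beta\<close>)
qed

end
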